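(* Let $\mathcal T$ be an FLD$_1$-theory having an atomic model $\mathbb X^{\rm at}$. Then for each FLD$_1$ decomposition $\mathbb X^{\rm at}=\sum_{\mathbb I}\mathbb X_i^{\rm at}$ of $\mathbb X^{\rm at}$ we have $I(\mathcal T)\le\prod_{i\in I}I(\mathbb X_i^{\rm at})$.
   Context: All structures are partial orders in the language $L_b=\langle\le\rangle$. For a complete $L_b$-theory $\mathcal T$, $I(\mathcal T)$ is the number of non-isomorphic countable models of $\mathcal T$; for a partial order $\mathbb X$, $I(\mathbb X):=I(\mathrm{Th}(\mathbb X))$, with $I(\mathbb X)=1$ when $\mathbb X$ is finite. Lexicographic sum: for a partial order $\mathbb I=\langle I,\le_{\mathbb I}\rangle$ and partial orders $\mathbb X_i$ ($i\in I$) with pairwise disjoint domains, $\sum_{\mathbb I}\mathbb X_i$ is the partial order on $\bigcup_i X_i$ with $x\le x'$ iff either $x,x'\in X_i$ and $x\le_{\mathbb X_i}x'$, or $x\in X_i$, $x'\in X_j$ with $i<_{\mathbb I}j$. A partial order $\mathbb X$ is FLD$_1$ iff $\mathbb X=\sum_{\mathbb I}\mathbb X_i$ for some finite partial order $\mathbb I$ and partition $\{X_i\}_{i\in I}$ of its domain (induced suborders $\mathbb X_i$) with each $\mathbb X_i$ having a largest element; this is an FLD$_1$ decomposition of $\mathbb X$. A complete theory of partial order is an FLD$_1$-theory iff some (equivalently every) model is FLD$_1$. *)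

theory Defs
  imports Main "HOL-Library.FuncSet" "HOL-Library.Disjoint_Sets" "HOL-Library.Countable_Set"
begin

unbundle cardinal_syntax

subsection \<open>First-order logic of one binary relation\<close>

datatype fm = Leq nat nat | Eq nat nat | Neg fm | Conj fm fm | Exists nat fm

definition Imp :: "fm \<Rightarrow> fm \<Rightarrow> fm" where
  "Imp \<phi> \<psi> = Neg (Conj \<phi> (Neg \<psi>))"

definition Forall :: "nat \<Rightarrow> fm \<Rightarrow> fm" where
  "Forall v \<phi> = Neg (Exists v (Neg \<phi>))"

fun fv :: "fm \<Rightarrow> nat set" where
  "fv (Leq i j) = {i, j}"
| "fv (Eq i j) = {i, j}"
| "fv (Neg \<phi>) = fv \<phi>"
| "fv (Conj \<phi> \<psi>) = fv \<phi> \<union> fv \<psi>"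
| "fv (Exists v \<phi>) = fv \<phi> - {v}"

definition sentence :: "fm \<Rightarrow> bool" where
  "sentence \<phi> \<longleftrightarrow> fv \<phi> = {}"

datatype 'a struct = Struct (universe: "'a set") (le: "'a rel")

definition is_structure :: "'a struct \<Rightarrow> bool" where
  "is_structure M \<longleftrightarrow> universe M \<noteq> {} \<and> le M \<subseteq> universe M \<times> universe M"

fun sat :: "'a struct \<Rightarrow> (nat \<Rightarrow> 'a) \<Rightarrow> fm \<Rightarrow> bool" where
  "sat M e (Leq i j) \<longleftrightarrow> (e i, e j) \<in> le M"
| "sat M e (Eq i j) \<longleftrightarrow> e i = e j"
| "sat M e (Neg \<phi>) \<longleftrightarrow> \<not> sat M e \<phi>"
| "sat M e (Conj \<phi> \<psi>) \<longleftrightarrow> sat M e \<phi> \<and> sat M e \<psi>"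
| "sat M e (Exists v \<phi>) \<longleftrightarrow> (\<exists>a\<in>universe M. sat M (e(v := a)) \<phi>)"

text \<open>Open formulas are read as their universal closures in \<open>valid_in\<close> and \<open>entails\<close>.\<close>

definition valid_in :: "'a struct \<Rightarrow> fm \<Rightarrow> bool" where
  "valid_in M \<phi> \<longleftrightarrow> (\<forall>e. range e \<subseteq> universe M \<longrightarrow> sat M e \<phi>)"

definition model :: "fm set \<Rightarrow> 'a struct \<Rightarrow> bool" where
  "model T M \<longleftrightarrow> is_structure M \<and> (\<forall>\<phi>\<in>T. valid_in M \<phi>)"

text \<open>A definition cannot quantify over models in all types. Models whose universe is a set of
  naturals suffice, since the language is countable; see \<open>entails_model\<close> below.\<close>

definition entails :: "fm set \<Rightarrow> fm \<Rightarrow> bool" where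
  "entails T \<phi> \<longleftrightarrow> (\<forall>M :: nat struct. model T M \<longrightarrow> valid_in M \<phi>)"

definition complete_theory :: "fm set \<Rightarrow> bool" where
  "complete_theory T \<longleftrightarrow> (\<forall>\<phi>\<in>T. sentence \<phi>) \<and> (\<exists>M :: nat struct. model T M) \<and>
     (\<forall>\<phi>. sentence \<phi> \<longrightarrow> entails T \<phi> \<or> entails T (Neg \<phi>))"

definition Th :: "'a struct \<Rightarrow> fm set" where
  "Th M = {\<phi>. sentence \<phi> \<and> valid_in M \<phi>}"

definition tuple_type :: "'a struct \<Rightarrow> nat \<Rightarrow> (nat \<Rightarrow> 'a) \<Rightarrow> fm set" where
  "tuple_type M n e = {\<phi>. fv \<phi> \<subseteq> {..<n} \<and> sat M e \<phi>}"

definition isolated_type :: "fm set \<Rightarrow> fm set \<Rightarrow> bool" where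
  "isolated_type T p \<longleftrightarrow> (\<exists>\<phi>\<in>p. \<forall>\<psi>\<in>p. entails T (Imp \<phi> \<psi>))"

definition atomic_model :: "fm set \<Rightarrow> 'a struct \<Rightarrow> bool" where
  "atomic_model T M \<longleftrightarrow> model T M \<and>
     (\<forall>n e. range e \<subseteq> universe M \<longrightarrow> isolated_type T (tuple_type M n e))"


subsection \<open>The number of countable models\<close>

definition is_iso :: "('a \<Rightarrow> 'b) \<Rightarrow> 'a struct \<Rightarrow> 'b struct \<Rightarrow> bool" where
  "is_iso f M N \<longleftrightarrow> bij_betw f (universe M) (universe N) \<and>
     (\<forall>x\<in>universe M. \<forall>y\<in>universe M. (x, y) \<in> le M \<longleftrightarrow> (f x, f y) \<in> le N)"

definition isomorphic :: "'a struct \<Rightarrow> 'b struct \<Rightarrow> bool" where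
  "isomorphic M N \<longleftrightarrow> (\<exists>f. is_iso f M N)"

text \<open>Countable means finite or countably infinite, so every countable model is isomorphic to one
  on a set of naturals (\<open>countable_copy\<close> below).\<close>

definition iso_classes :: "fm set \<Rightarrow> nat struct set set" where
  "iso_classes T = {M. model T M} // {(M, N). model T M \<and> model T N \<and> isomorphic M N}"

definition num_models :: "fm set \<Rightarrow> nat struct set rel" where
  "num_models T = |iso_classes T|"

text \<open>For finite \<open>X\<close> this number is 1; see \<open>num_models_of_finite\<close> below.\<close>

definition num_models_of :: "'a struct \<Rightarrow> nat struct set rel" where
  "num_models_of X = num_models (Th X)"

definition cardinal_prod :: "'i set \<Rightarrow> ('i \<Rightarrow> 'b rel) \<Rightarrow> ('i \<Rightarrow> 'b) rel" where
  "cardinal_prod I \<kappa> = |\<Pi>\<^sub>E i\<in>I. Field (\<kappa> i)|"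


subsection \<open>Lexicographic sums and FLD1 theories\<close>

definition partial_order :: "'a struct \<Rightarrow> bool" where
  "partial_order X \<longleftrightarrow> partial_order_on (universe X) (le X)"

definition induced :: "'a struct \<Rightarrow> 'a set \<Rightarrow> 'a struct" where
  "induced X A = Struct A (le X \<inter> A \<times> A)"

definition lex_sum :: "'i struct \<Rightarrow> ('i \<Rightarrow> 'a struct) \<Rightarrow> 'a struct" where
  "lex_sum I Xs = Struct (\<Union>i\<in>universe I. universe (Xs i))
     {(x, y). (\<exists>i\<in>universe I. x \<in> universe (Xs i) \<and> y \<in> universe (Xs i) \<and> (x, y) \<in> le (Xs i)) \<or>
              (\<exists>i\<in>universe I. \<exists>j\<in>universe I. x \<in> universe (Xs i) \<and> y \<in> universe (Xs j) \<and> (i, j) \<in> le I \<and> i \<noteq> j)}"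

definition has_largest :: "'a struct \<Rightarrow> bool" where
  "has_largest X \<longleftrightarrow> (\<exists>m\<in>universe X. \<forall>x\<in>universe X. (x, m) \<in> le X)"

definition FLD1_decomposition :: "'a struct \<Rightarrow> 'i struct \<Rightarrow> ('i \<Rightarrow> 'a set) \<Rightarrow> bool" where
  "FLD1_decomposition X I D \<longleftrightarrow>
     finite (universe I) \<and> partial_order I \<and>
     disjoint_family_on D (universe I) \<and> (\<Union>i\<in>universe I. D i) = universe X \<and>
     X = lex_sum I (\<lambda>i. induced X (D i)) \<and>
     (\<forall>i\<in>universe I. has_largest (induced X (D i)))"

text \<open>A finite index order has a copy on a set of naturals.\<close>

definition FLD1 :: "'a struct \<Rightarrow> bool" where
  "FLD1 X \<longleftrightarrow> partial_order X \<and> (\<exists>(I :: nat struct) D. FLD1_decomposition X I D)"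

definition po_axioms :: "fm set" where
  "po_axioms = {Forall 0 (Leq 0 0),
     Forall 0 (Forall 1 (Imp (Conj (Leq 0 1) (Leq 1 0)) (Eq 0 1))),
     Forall 0 (Forall 1 (Forall 2 (Imp (Conj (Leq 0 1) (Leq 1 2)) (Leq 0 2))))}"

definition FLD1_theory :: "fm set \<Rightarrow> bool" where
  "FLD1_theory T \<longleftrightarrow> complete_theory T \<and> (\<forall>\<phi>\<in>po_axioms. entails T \<phi>) \<and>
     (\<exists>M :: nat struct. model T M \<and> FLD1 M)"


subsection \<open>Adequacy of the definitions\<close>

lemma sat_cong: "(\<And>v. v \<in> fv \<phi> \<Longrightarrow> e v = e' v) \<Longrightarrow> sat M e \<phi> \<longleftrightarrow> sat M e' \<phi>"
proof (induction \<phi> arbitrary: e e')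
  case (Conj \<phi> \<psi>)
  have "sat M e \<phi> \<longleftrightarrow> sat M e' \<phi>" "sat M e \<psi> \<longleftrightarrow> sat M e' \<psi>"
    using Conj.prems by (auto intro!: Conj.IH)
  then show ?case by simp
next
  case (Exists v \<phi>)
  have "sat M (e(v := a)) \<phi> \<longleftrightarrow> sat M (e'(v := a)) \<phi>" for a
    using Exists.prems by (intro Exists.IH) auto
  then show ?case by simp
next
  case (Neg \<phi>)
  have "sat M e \<phi> \<longleftrightarrow> sat M e' \<phi>" using Neg.prems by (intro Neg.IH) auto
  then show ?case by simp
qed auto

lemma finite_fv: "finite (fv \<phi>)"
  by (induction \<phi>) auto

lemma sat_iso:
  assumes "is_iso f M N" "range e \<subseteq> universe M"
  shows "sat M e \<phi> \<longleftrightarrow> sat N (f \<circ> e) \<phi>"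
  using assms(2)
proof (induction \<phi> arbitrary: e)
  case (Leq i j)
  then have "e i \<in> universe M" "e j \<in> universe M" by auto
  then show ?case using assms(1) by (simp add: is_iso_def)
next
  case (Eq i j)
  then have "e i \<in> universe M" "e j \<in> universe M" by auto
  then show ?case using assms(1) by (auto simp: is_iso_def bij_betw_def dest: inj_onD)
next
  case (Exists v \<phi>)
  have *: "sat M (e(v := a)) \<phi> \<longleftrightarrow> sat N ((f \<circ> e)(v := f a)) \<phi>" if "a \<in> universe M" for a
  proof -
    have "range (e(v := a)) \<subseteq> universe M" using Exists.prems that by auto
    moreover have "f \<circ> e(v := a) = (f \<circ> e)(v := f a)" by auto
    ultimately show ?thesis using Exists.IH[of "e(v := a)"] by (simp del: fun_upd_apply)
  qed
  have "universe N = f ` universe M" using assms(1) by (auto simp: is_iso_def bij_betw_def)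
  then show ?case using * by (simp del: o_apply)
qed auto

lemma valid_in_iso:
  fixes M :: "'a struct" and N :: "'b struct"
  assumes "is_iso f M N"
  shows "valid_in M \<phi> \<longleftrightarrow> valid_in N \<phi>"
proof
  have f: "bij_betw f (universe M) (universe N)" using assms by (simp add: is_iso_def)
  {
    assume M: "valid_in M \<phi>"
    show "valid_in N \<phi>"
      unfolding valid_in_def
    proof (intro allI impI)
      fix e :: "nat \<Rightarrow> 'b" assume e: "range e \<subseteq> universe N"
      define e' where "e' = inv_into (universe M) f \<circ> e"
      have "range e' \<subseteq> universe M"
        using e f by (auto simp: e'_def bij_betw_def intro!: inv_into_into)
      moreover have "f \<circ> e' = e"
        using e f by (auto simp: e'_def bij_betw_def fun_eq_iff intro!: f_inv_into_f)
      ultimately show "sat N e \<phi>"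
        using M sat_iso[OF assms, of e'] by (auto simp: valid_in_def)
    qed
  }
  {
    assume N: "valid_in N \<phi>"
    show "valid_in M \<phi>"
      unfolding valid_in_def
    proof (intro allI impI)
      fix e :: "nat \<Rightarrow> 'a" assume e: "range e \<subseteq> universe M"
      then have "range (f \<circ> e) \<subseteq> universe N" using f by (auto simp: bij_betw_def)
      then show "sat M e \<phi>" using N sat_iso[OF assms e] by (auto simp: valid_in_def)
    qed
  }
qed

lemma countable_copy:
  fixes M :: "'a struct"
  assumes "is_structure M" "countable (universe M)"
  obtains N :: "nat struct" and f where "is_structure N" "is_iso f M N"
proof -
  obtain f :: "'a \<Rightarrow> nat" where f: "inj_on f (universe M)"
    using assms(2) by (auto simp: countable_def)
  define N where "N = Struct (f ` universe M) (map_prod f f ` le M)"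
  have "is_structure N" using assms(1) by (auto simp: is_structure_def N_def)
  moreover have "is_iso f M N"
    unfolding is_iso_def
  proof (intro conjI ballI)
    show "bij_betw f (universe M) (universe N)" using f by (simp add: bij_betw_def N_def)
    fix x y assume xy: "x \<in> universe M" "y \<in> universe M"
    show "(x, y) \<in> le M \<longleftrightarrow> (f x, f y) \<in> le N"
    proof
      assume "(f x, f y) \<in> le N"
      then obtain x' y' where *: "(x', y') \<in> le M" "f x = f x'" "f y = f y'"
        by (auto simp: N_def)
      then have "x' \<in> universe M" "y' \<in> universe M" using assms(1) by (auto simp: is_structure_def)
      then have "x = x'" "y = y'" using f xy * by (auto dest: inj_onD)
      then show "(x, y) \<in> le M" using * by simp
    qed (force simp: N_def)
  qed
  ultimately show ?thesis using that by blast
qed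

instance fm :: countable by countable_datatype

lemma Lowenheim_Skolem:
  fixes M :: "'a struct"
  assumes M: "is_structure M" and A: "countable A" "A \<subseteq> universe M"
  obtains S where "countable S" "A \<subseteq> S" "S \<subseteq> universe M" "S \<noteq> {}"
    "\<And>e \<phi>. range e \<subseteq> S \<Longrightarrow> sat (induced M S) e \<phi> \<longleftrightarrow> sat M e \<phi>"
proof -
  obtain a0 where a0: "a0 \<in> universe M" using M by (auto simp: is_structure_def)
  define asg where "asg xs = (\<lambda>i. if i < length xs then xs ! i else a0)" for xs :: "'a list"
  define w where "w p = (case p of (v, \<phi>, xs) \<Rightarrow>
    if \<exists>a\<in>universe M. sat M ((asg xs)(v := a)) \<phi>
    then SOME a. a \<in> universe M \<and> sat M ((asg xs)(v := a)) \<phi> else a0)"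
    for p :: "nat \<times> fm \<times> 'a list"
  have w_in: "w p \<in> universe M" for p
  proof (cases p)
    case (fields v \<phi> xs)
    show ?thesis
    proof (cases "\<exists>a\<in>universe M. sat M ((asg xs)(v := a)) \<phi>")
      case True
      then have "\<exists>a. a \<in> universe M \<and> sat M ((asg xs)(v := a)) \<phi>" by blast
      from someI_ex[OF this] True show ?thesis by (simp add: w_def fields)
    next
      case False
      then show ?thesis using a0 by (simp add: w_def fields)
    qed
  qed
  define F where "F = (\<lambda>n. rec_nat (insert a0 A)
    (\<lambda>_ S. S \<union> w ` (UNIV \<times> UNIV \<times> lists S)) n)"
  have F0: "F 0 = insert a0 A" and FS: "F (Suc n) = F n \<union> w ` (UNIV \<times> UNIV \<times> lists (F n))" for n
    by (simp_all add: F_def)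
  have cF: "countable (F n)" for n
    by (induction n) (use A in \<open>auto simp: F0 FS intro!: countable_image countable_SIGMA countable_lists\<close>)
  have uF: "F n \<subseteq> universe M" for n
    by (induction n) (use A a0 w_in in \<open>auto simp: F0 FS\<close>)
  have mF: "m \<le> n \<Longrightarrow> F m \<subseteq> F n" for m n
    by (rule lift_Suc_mono_le[of F]) (auto simp: FS)
  define S where "S = (\<Union>n. F n)"
  have S: "countable S" "A \<subseteq> S" "S \<subseteq> universe M" "a0 \<in> S"
    using cF uF F0 by (auto simp: S_def)
  have fin: "\<exists>n. B \<subseteq> F n" if "finite B" "B \<subseteq> S" for B
    using that
  proof (induction B)
    case (insert b B)
    then obtain n m where "B \<subseteq> F n" "b \<in> F m" by (auto simp: S_def)
    moreover have "F n \<subseteq> F (max n m)" "F m \<subseteq> F (max n m)" by (auto intro!: mF)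
    ultimately show ?case by (intro exI[of _ "max n m"]) auto
  qed auto
  have wit: "\<exists>a\<in>S. sat M (e(v := a)) \<phi>"
    if e: "range e \<subseteq> S" and ex: "\<exists>a\<in>universe M. sat M (e(v := a)) \<phi>" for e v \<phi>
  proof -
    obtain N where N: "\<And>i. i \<in> fv \<phi> \<Longrightarrow> i < N"
      using finite_nat_set_iff_bounded finite_fv by metis
    define xs where "xs = map e [0..<N]"
    have eq: "sat M (e(v := a)) \<phi> \<longleftrightarrow> sat M ((asg xs)(v := a)) \<phi>" for a
      by (rule sat_cong) (use N in \<open>auto simp: asg_def xs_def\<close>)
    obtain n where n: "set xs \<subseteq> F n" using fin[of "set xs"] e by (auto simp: xs_def)
    have "w (v, \<phi>, xs) \<in> F (Suc n)" using n by (auto simp: FS)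
    then have "w (v, \<phi>, xs) \<in> S" by (auto simp: S_def)
    moreover have "sat M ((asg xs)(v := w (v, \<phi>, xs))) \<phi>"
    proof -
      have *: "\<exists>a\<in>universe M. sat M ((asg xs)(v := a)) \<phi>" using ex eq by simp
      then have "\<exists>a. a \<in> universe M \<and> sat M ((asg xs)(v := a)) \<phi>" by blast
      from someI_ex[OF this] * show ?thesis by (simp add: w_def)
    qed
    ultimately show ?thesis using eq by blast
  qed
  have "sat (induced M S) e \<phi> \<longleftrightarrow> sat M e \<phi>" if "range e \<subseteq> S" for e \<phi>
    using that
  proof (induction \<phi> arbitrary: e)
    case (Exists v \<phi>)
    have "sat (induced M S) (e(v := a)) \<phi> \<longleftrightarrow> sat M (e(v := a)) \<phi>" if "a \<in> S" for a
      using Exists.prems that by (intro Exists.IH) auto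
    then have "sat (induced M S) e (Exists v \<phi>) \<longleftrightarrow> (\<exists>a\<in>S. sat M (e(v := a)) \<phi>)"
      by (simp add: induced_def)
    then show ?case using wit[OF Exists.prems, of v \<phi>] S(3) by auto
  qed (auto simp: induced_def)
  then show ?thesis using S that by blast
qed

lemma entails_model:
  fixes M :: "'a struct"
  assumes T: "\<forall>\<phi>\<in>T. sentence \<phi>" and "entails T \<phi>" "model T M"
  shows "valid_in M \<phi>"
  unfolding valid_in_def
proof (intro allI impI)
  fix e :: "nat \<Rightarrow> 'a" assume e: "range e \<subseteq> universe M"
  have M: "is_structure M" using assms(3) by (simp add: model_def)
  obtain S where S: "countable S" "range e \<subseteq> S" "S \<subseteq> universe M" "S \<noteq> {}"
    and el: "\<And>e \<phi>. range e \<subseteq> S \<Longrightarrow> sat (induced M S) e \<phi> \<longleftrightarrow> sat M e \<phi>"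
    using Lowenheim_Skolem[OF M _ e] by auto
  have "is_structure (induced M S)" "countable (universe (induced M S))"
    using S by (auto simp: is_structure_def induced_def)
  then obtain N :: "nat struct" and f where N: "is_structure N" "is_iso f (induced M S) N"
    by (rule countable_copy)
  have "valid_in N \<psi>" if "\<psi> \<in> T" for \<psi>
  proof -
    have "valid_in M \<psi>" using assms(3) that by (simp add: model_def)
    then have "valid_in (induced M S) \<psi>"
      using S(3) el by (auto simp: valid_in_def induced_def)
    then show ?thesis using valid_in_iso[OF N(2)] by simp
  qed
  then have "valid_in N \<phi>" using assms(2) N(1) by (auto simp: entails_def model_def)
  then have "valid_in (induced M S) \<phi>" using valid_in_iso[OF N(2)] by simp
  then show "sat M e \<phi>" using S(2) el by (auto simp: valid_in_def induced_def)
qed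

fun conjs :: "fm list \<Rightarrow> fm" where
  "conjs [] = Eq 0 0"
| "conjs (\<phi> # \<phi>s) = Conj \<phi> (conjs \<phi>s)"

fun exs :: "nat \<Rightarrow> fm \<Rightarrow> fm" where
  "exs 0 \<phi> = \<phi>"
| "exs (Suc n) \<phi> = exs n (Exists n \<phi>)"

lemma sat_conjs: "sat M e (conjs \<phi>s) \<longleftrightarrow> (\<forall>\<phi>\<in>set \<phi>s. sat M e \<phi>)"
  by (induction \<phi>s) auto

lemma fv_conjs: "fv (conjs \<phi>s) = insert 0 (\<Union>\<phi>\<in>set \<phi>s. fv \<phi>)"
  by (induction \<phi>s) auto

lemma fv_exs: "fv (exs n \<phi>) = fv \<phi> - {..<n}"
  by (induction n arbitrary: \<phi>) (auto simp: lessThan_Suc)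

lemma sat_exs:
  "sat M e (exs n \<phi>) \<longleftrightarrow> (\<exists>e'. (\<forall>i<n. e' i \<in> universe M) \<and> (\<forall>i\<ge>n. e' i = e i) \<and> sat M e' \<phi>)"
proof (induction n arbitrary: \<phi>)
  case 0
  have "e' = e" if "\<forall>i. e' i = e i" for e' using that by auto
  then show ?case by auto
next
  case (Suc n)
  show ?case
  proof
    assume "sat M e (exs (Suc n) \<phi>)"
    then obtain e' a where "\<forall>i<n. e' i \<in> universe M" "\<forall>i\<ge>n. e' i = e i" "a \<in> universe M"
      "sat M (e'(n := a)) \<phi>"
      by (auto simp: Suc)
    then show "\<exists>e'. (\<forall>i<Suc n. e' i \<in> universe M) \<and> (\<forall>i\<ge>Suc n. e' i = e i) \<and> sat M e' \<phi>"
      by (intro exI[of _ "e'(n := a)"]) auto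
  next
    assume "\<exists>e'. (\<forall>i<Suc n. e' i \<in> universe M) \<and> (\<forall>i\<ge>Suc n. e' i = e i) \<and> sat M e' \<phi>"
    then obtain e' where e': "\<forall>i<Suc n. e' i \<in> universe M" "\<forall>i\<ge>Suc n. e' i = e i" "sat M e' \<phi>"
      by blast
    have "(e'(n := e n))(n := e' n) = e'" by auto
    then have "sat M (e'(n := e n)) (Exists n \<phi>)"
      using e' by (auto intro!: bexI[of _ "e' n"])
    then show "sat M e (exs (Suc n) \<phi>)"
      unfolding exs.simps Suc using e' by (intro exI[of _ "e'(n := e n)"]) auto
  qed
qed

lemma finite_model_unique:
  fixes X :: "'a struct" and N :: "'b struct"
  assumes X: "is_structure X" "finite (universe X)" and N: "model (Th X) N"
  shows "isomorphic X N"
proof -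
  obtain xs where xs: "set xs = universe X" "distinct xs"
    using X(2) finite_distinct_list by blast
  define n where "n = length xs"
  have n: "n > 0" using X(1) xs by (auto simp: n_def is_structure_def)
  have U: "universe X = (!) xs ` {..<n}"
    unfolding xs(1)[symmetric] set_conv_nth n_def by auto
  have inj: "xs ! i = xs ! j \<longleftrightarrow> i = j" if "i < n" "j < n" for i j
    using that xs(2) by (simp add: n_def nth_eq_iff_index_eq)
  define D1 where "D1 = map (\<lambda>(i, j). if (xs ! i, xs ! j) \<in> le X then Leq i j else Neg (Leq i j))
    (List.product [0..<n] [0..<n])"
  define D2 where "D2 = map (\<lambda>(i, j). if i = j then Eq i j else Neg (Eq i j))
    (List.product [0..<n] [0..<n])"
  define D3 where "D3 = Neg (Exists n (conjs (map (\<lambda>i. Neg (Eq n i)) [0..<n])))"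
  define \<delta> where "\<delta> = conjs (D3 # D1 @ D2)"
  have sat_\<delta>: "sat M e \<delta> \<longleftrightarrow>
      (\<forall>i<n. \<forall>j<n. ((e i, e j) \<in> le M \<longleftrightarrow> (xs ! i, xs ! j) \<in> le X) \<and> (e i = e j \<longleftrightarrow> i = j)) \<and>
      (\<forall>a\<in>universe M. \<exists>i<n. a = e i)" for M :: "'c struct" and e
  proof -
    have "sat M e (conjs D1) \<longleftrightarrow> (\<forall>i<n. \<forall>j<n. (e i, e j) \<in> le M \<longleftrightarrow> (xs ! i, xs ! j) \<in> le X)"
      by (fastforce simp: sat_conjs D1_def split: if_splits)
    moreover have "sat M e (conjs D2) \<longleftrightarrow> (\<forall>i<n. \<forall>j<n. e i = e j \<longleftrightarrow> i = j)"
      by (fastforce simp: sat_conjs D2_def split: if_splits)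
    moreover have "sat M e D3 \<longleftrightarrow> (\<forall>a\<in>universe M. \<exists>i<n. a = e i)"
      by (fastforce simp: sat_conjs D3_def)
    ultimately show ?thesis
      unfolding \<delta>_def sat_conjs by (auto simp: sat_conjs)
  qed
  have "fv \<phi> \<subseteq> {..<n}" if "\<phi> \<in> set (D3 # D1 @ D2)" for \<phi>
    using that n by (auto simp: D1_def D2_def D3_def fv_conjs split: if_splits)
  then have "fv \<delta> \<subseteq> {..<n}" unfolding \<delta>_def fv_conjs using n by blast
  then have sent: "sentence (exs n \<delta>)" by (auto simp: sentence_def fv_exs)
  have "valid_in X (exs n \<delta>)"
    unfolding valid_in_def sat_exs
  proof (intro allI impI)
    fix e :: "nat \<Rightarrow> 'a"
    let ?e = "\<lambda>i. if i < n then xs ! i else e i"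
    have "sat X ?e \<delta>"
      unfolding sat_\<delta> U by (auto simp: inj)
    then show "\<exists>e'. (\<forall>i<n. e' i \<in> universe X) \<and> (\<forall>i\<ge>n. e' i = e i) \<and> sat X e' \<delta>"
      by (intro exI[of _ ?e]) (simp add: U)
  qed
  then have "valid_in N (exs n \<delta>)" using N sent by (auto simp: model_def Th_def)
  moreover obtain b where "b \<in> universe N" using N by (auto simp: model_def is_structure_def)
  ultimately have "sat N (\<lambda>_. b) (exs n \<delta>)" by (auto simp: valid_in_def)
  then obtain e where e: "\<forall>i<n. e i \<in> universe N" "sat N e \<delta>" by (auto simp: sat_exs)
  define ix where "ix x = (THE i. i < n \<and> xs ! i = x)" for x
  have ix: "ix (xs ! i) = i" if "i < n" for i
    unfolding ix_def using that by (intro the_equality) (auto simp: inj)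
  have "bij_betw (e \<circ> ix) (universe X) (universe N)"
    unfolding bij_betw_def using e by (auto simp: U sat_\<delta> ix inj_on_def image_iff)
  moreover have "\<forall>x\<in>universe X. \<forall>y\<in>universe X. (x, y) \<in> le X \<longleftrightarrow> ((e \<circ> ix) x, (e \<circ> ix) y) \<in> le N"
    using e by (auto simp: U sat_\<delta> ix)
  ultimately show ?thesis unfolding isomorphic_def is_iso_def by blast
qed

lemma isomorphic_sym: "isomorphic M N \<Longrightarrow> isomorphic N M"
proof -
  assume "isomorphic M N"
  then obtain f where f: "bij_betw f (universe M) (universe N)"
    "\<forall>x\<in>universe M. \<forall>y\<in>universe M. (x, y) \<in> le M \<longleftrightarrow> (f x, f y) \<in> le N"
    by (auto simp: isomorphic_def is_iso_def)
  let ?g = "inv_into (universe M) f"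
  have g: "?g y \<in> universe M" "f (?g y) = y" if "y \<in> universe N" for y
    using f(1) that by (auto simp: bij_betw_def inv_into_into f_inv_into_f)
  show ?thesis
    unfolding isomorphic_def is_iso_def
    using bij_betw_inv_into[OF f(1)] f(2) g by (intro exI[of _ ?g]) auto
qed

lemma isomorphic_trans: "isomorphic M N \<Longrightarrow> isomorphic N K \<Longrightarrow> isomorphic M K"
proof -
  assume "isomorphic M N" "isomorphic N K"
  then obtain f g where fg: "is_iso f M N" "is_iso g N K" by (auto simp: isomorphic_def)
  have "f x \<in> universe N" if "x \<in> universe M" for x
    using fg(1) that by (auto simp: is_iso_def bij_betw_def)
  then have "is_iso (g \<circ> f) M K"
    using fg by (auto simp: is_iso_def intro: bij_betw_trans)
  then show ?thesis by (auto simp: isomorphic_def)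
qed

lemma num_models_of_finite:
  fixes X :: "'a struct"
  assumes X: "is_structure X" "finite (universe X)"
  obtains c where "num_models_of X = |{c}|"
proof -
  obtain N :: "nat struct" and f where N: "is_structure N" "is_iso f X N"
    by (rule countable_copy[OF X(1) countable_finite[OF X(2)]])
  have mN: "model (Th X) N"
    using N valid_in_iso[OF N(2)] by (auto simp: model_def Th_def)
  let ?R = "{(M :: nat struct, K :: nat struct). model (Th X) M \<and> model (Th X) K \<and> isomorphic M K}"
  have "isomorphic M K" if "model (Th X) M" "model (Th X) K" for M K :: "nat struct"
    using isomorphic_trans[OF isomorphic_sym[OF finite_model_unique[OF X that(1)]]
      finite_model_unique[OF X that(2)]] .
  then have R: "?R `` {M} = {K. model (Th X) K}" if "model (Th X) M" for M
    using that by auto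
  have "iso_classes (Th X) = {{K. model (Th X) K}}"
    using mN R by (auto simp: iso_classes_def quotient_def)
  then show ?thesis using that by (simp add: num_models_of_def num_models_def)
qed

end

theory Submission
  imports Defs
begin

text \<open>The largest elements \<open>m\<^sub>j\<close> of the summands of the atomic model \<open>X\<close> form a finite tuple, whose
  type is isolated and hence realized by a tuple \<open>a\<close> in every model \<open>M\<close> of the theory. An element
  \<open>x\<close> of \<open>X\<close> lies in the \<open>i\<close>-th summand iff \<open>x \<le> m\<^sub>j\<close> holds exactly for those \<open>j\<close> with \<open>i \<le> j\<close>, so
  the summands are uniformly definable from the tuple. The same formulas with parameters \<open>a\<close> split
  \<open>M\<close> into a lexicographic sum over the same index order, and by relativization each summand of \<open>M\<close>
  is elementarily equivalent to the corresponding summand of \<open>X\<close>. As isomorphisms between summands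
  glue, the isomorphism type of \<open>M\<close> is determined by the isomorphism types of these summands.\<close>

section \<open>Lexicographic decompositions\<close>

text \<open>Only comparisons between different parts are constrained, and the parts need not have
  largest elements. For a finite \<open>I\<close>, these conditions are first-order as soon as the
  parts are definable.\<close>

definition lex_decomposition :: "'a struct \<Rightarrow> 'i struct \<Rightarrow> ('i \<Rightarrow> 'a set) \<Rightarrow> bool" where
  "lex_decomposition M I P \<longleftrightarrow>
     disjoint_family_on P (universe I) \<and> (\<Union>i\<in>universe I. P i) = universe M \<and>
     (\<forall>i\<in>universe I. \<forall>j\<in>universe I. i \<noteq> j \<longrightarrow>
        (\<forall>x\<in>P i. \<forall>y\<in>P j. (x, y) \<in> le M \<longleftrightarrow> (i, j) \<in> le I))"

text \<open>Comparisons inside a part are preserved by the given isomorphism, and those between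
  different parts are dictated by \<open>I\<close> on both sides, so the isomorphisms glue.\<close>

lemma isomorphic_if_summands_isomorphic:
  assumes M: "lex_decomposition M I P" and N: "lex_decomposition N I Q"
    and iso: "\<And>i. i \<in> universe I \<Longrightarrow> isomorphic (induced M (P i)) (induced N (Q i))"
  shows "isomorphic M N"
proof -
  obtain f where f: "\<And>i. i \<in> universe I \<Longrightarrow> is_iso (f i) (induced M (P i)) (induced N (Q i))"
    using iso unfolding isomorphic_def by metis
  have f_bij: "bij_betw (f i) (P i) (Q i)" if "i \<in> universe I" for i
    using f[OF that] by (simp add: is_iso_def induced_def)
  have f_in: "f i x \<in> Q i" if "i \<in> universe I" "x \<in> P i" for i x
    using f_bij[OF that(1)] that(2) by (auto simp: bij_betw_def)
  have f_le: "(x, y) \<in> le M \<longleftrightarrow> (f i x, f i y) \<in> le N"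
    if "i \<in> universe I" "x \<in> P i" "y \<in> P i" for i x y
    using f[OF that(1)] f_in[OF that(1)] that(2,3) by (simp add: is_iso_def induced_def)
  have P_unique: "i = j" if "i \<in> universe I" "j \<in> universe I" "x \<in> P i" "x \<in> P j" for i j x
    using M that by (auto simp: lex_decomposition_def disjoint_family_on_def)
  have Q_unique: "i = j" if "i \<in> universe I" "j \<in> universe I" "x \<in> Q i" "x \<in> Q j" for i j x
    using N that by (auto simp: lex_decomposition_def disjoint_family_on_def)
  have M_un: "universe M = (\<Union>i\<in>universe I. P i)" and N_un: "universe N = (\<Union>i\<in>universe I. Q i)"
    using M N by (auto simp: lex_decomposition_def)
  \<comment> \<open>Disjointness makes the part containing \<open>x\<close> unique, so
    \<open>g\<close> is the union of the maps \<open>f i\<close>.\<close>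
  define g where "g x = f (THE i. i \<in> universe I \<and> x \<in> P i) x" for x
  have g: "g x = f i x" if "i \<in> universe I" "x \<in> P i" for i x
  proof -
    have "(THE i. i \<in> universe I \<and> x \<in> P i) = i"
      using that P_unique by (intro the_equality) auto
    then show ?thesis by (simp add: g_def)
  qed
  have "inj_on g (universe M)"
  proof (rule inj_onI)
    fix x y assume "x \<in> universe M" "y \<in> universe M" and eq: "g x = g y"
    then obtain i j where ij: "i \<in> universe I" "x \<in> P i" "j \<in> universe I" "y \<in> P j"
      by (auto simp: M_un)
    then have eq': "f i x = f j y" using eq g by simp
    then have "i = j" using Q_unique[of i j "f i x"] f_in ij by metis
    then show "x = y" using eq' f_bij ij by (auto simp: bij_betw_def dest: inj_onD)
  qed
  moreover have "g ` universe M = universe N"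
  proof -
    have "g ` P i = Q i" if "i \<in> universe I" for i
      using f_bij[OF that] g[OF that] by (auto simp: bij_betw_def image_iff)
    then show ?thesis by (simp add: M_un N_un image_UN)
  qed
  moreover have "(x, y) \<in> le M \<longleftrightarrow> (g x, g y) \<in> le N"
    if xy: "x \<in> universe M" "y \<in> universe M" for x y
  proof -
    obtain i j where ij: "i \<in> universe I" "x \<in> P i" "j \<in> universe I" "y \<in> P j"
      using xy by (auto simp: M_un)
    show ?thesis
    proof (cases "i = j")
      case True
      then show ?thesis using f_le ij g by auto
    next
      case False
      then have "(x, y) \<in> le M \<longleftrightarrow> (i, j) \<in> le I" "(f i x, f j y) \<in> le N \<longleftrightarrow> (i, j) \<in> le I"
        using M N ij f_in by (auto simp: lex_decomposition_def)
      then show ?thesis using g ij by simp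
    qed
  qed
  ultimately show ?thesis by (auto simp: isomorphic_def is_iso_def bij_betw_def)
qed

section \<open>Relativization\<close>

text \<open>The variables of \<open>\<phi>\<close> are shifted by \<open>n\<close>, which frees the variables below \<open>n\<close> for the parameters
  of the relativizing formulas \<open>\<delta> v\<close>.\<close>

fun relativize :: "nat \<Rightarrow> (nat \<Rightarrow> fm) \<Rightarrow> fm \<Rightarrow> fm" where
  "relativize n \<delta> (Leq i j) = Leq (i + n) (j + n)"
| "relativize n \<delta> (Eq i j) = Eq (i + n) (j + n)"
| "relativize n \<delta> (Neg \<phi>) = Neg (relativize n \<delta> \<phi>)"
| "relativize n \<delta> (Conj \<phi> \<psi>) = Conj (relativize n \<delta> \<phi>) (relativize n \<delta> \<psi>)"
| "relativize n \<delta> (Exists v \<phi>) = Exists (v + n) (Conj (\<delta> (v + n)) (relativize n \<delta> \<phi>))"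

lemma fv_relativize:
  assumes "\<And>v. fv (\<delta> v) \<subseteq> insert v {..<n}"
  shows "fv (relativize n \<delta> \<phi>) \<subseteq> {..<n} \<union> (\<lambda>v. v + n) ` fv \<phi>"
proof (induction \<phi>)
  case (Exists v \<phi>)
  then show ?case using assms[of "v + n"] by auto
qed auto

text \<open>Induction on \<open>\<phi>\<close>: a bound variable \<open>v + n\<close> lies above the
  parameters, so updating it leaves the values \<open>a k\<close> intact. For this the hypothesis on
  \<open>\<delta>\<close> covers every assignment that agrees with \<open>a\<close> below
  \<open>n\<close>.\<close>

lemma sat_relativize:
  assumes \<delta>: "\<And>e v. (\<And>k. k < n \<Longrightarrow> e k = a k) \<Longrightarrow> n \<le> v \<Longrightarrow> e v \<in> universe M \<Longrightarrow>
      sat M e (\<delta> v) \<longleftrightarrow> e v \<in> A"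
    and A: "A \<subseteq> universe M"
    and "\<And>k. k < n \<Longrightarrow> e k = a k" and "\<And>v. e (v + n) \<in> A"
  shows "sat M e (relativize n \<delta> \<phi>) \<longleftrightarrow> sat (induced M A) (\<lambda>v. e (v + n)) \<phi>"
  using assms(3,4)
proof (induction \<phi> arbitrary: e)
  case (Exists v \<phi>)
  have "sat M (e(v + n := x)) (\<delta> (v + n)) \<longleftrightarrow> x \<in> A" if "x \<in> universe M" for x
    using \<delta>[of "e(v + n := x)" "v + n"] Exists.prems that by simp
  moreover have "sat M (e(v + n := x)) (relativize n \<delta> \<phi>) \<longleftrightarrow>
      sat (induced M A) ((\<lambda>v. e (v + n))(v := x)) \<phi>" if "x \<in> A" for x
  proof -
    have "(\<lambda>w. (e(v + n := x)) (w + n)) = (\<lambda>v. e (v + n))(v := x)" by auto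
    then show ?thesis using Exists.IH[of "e(v + n := x)"] Exists.prems that
      by (simp del: fun_upd_apply) (simp add: fun_upd_def)
  qed
  ultimately show ?case using A by (auto simp: induced_def)
qed (auto simp: induced_def)

text \<open>The relativization of a sentence has only parameters as free variables, so its truth
  depends only on \<open>a\<close> below \<open>n\<close>. Validity in a definable suborder thus
  becomes part of the type of the parameters.\<close>

lemma induced_part_valid_iff:
  assumes \<delta>: "\<And>e v. (\<And>k. k < n \<Longrightarrow> e k = a k) \<Longrightarrow> n \<le> v \<Longrightarrow> e v \<in> universe M \<Longrightarrow>
      sat M e (\<delta> v) \<longleftrightarrow> e v \<in> A"
    and fv: "\<And>v. fv (\<delta> v) \<subseteq> insert v {..<n}"
    and A: "A \<subseteq> universe M" "A \<noteq> {}" and \<phi>: "sentence \<phi>"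
  shows "valid_in (induced M A) \<phi> \<longleftrightarrow> sat M a (relativize n \<delta> \<phi>)"
proof -
  have "sat (induced M A) e \<phi> \<longleftrightarrow> sat M a (relativize n \<delta> \<phi>)" if "range e \<subseteq> A" for e
  proof -
    \<comment> \<open>The parameters occupy the variables below \<open>n\<close>; reading
      \<open>?e\<close> at \<open>v + n\<close> gives back \<open>e\<close>.\<close>
    let ?e = "\<lambda>v. if v < n then a v else e (v - n)"
    have "sat M ?e (relativize n \<delta> \<phi>) \<longleftrightarrow> sat (induced M A) (\<lambda>v. ?e (v + n)) \<phi>"
      by (rule sat_relativize[of n a, OF \<delta> A(1)]) (use that in auto)
    moreover have "sat M ?e (relativize n \<delta> \<phi>) \<longleftrightarrow> sat M a (relativize n \<delta> \<phi>)"
      by (rule sat_cong) (use fv_relativize[of \<delta> n \<phi>, OF fv] \<phi> in \<open>auto simp: sentence_def\<close>)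
    ultimately show ?thesis by simp
  qed
  \<comment> \<open>A constant assignment into \<open>A\<close> keeps validity from being
    vacuous.\<close>
  moreover obtain x where "x \<in> A" using A(2) by blast
  then have "range (\<lambda>_. x) \<subseteq> A" by auto
  ultimately show ?thesis by (auto simp: valid_in_def induced_def simp del: image_subset_iff)
qed

section \<open>Realizing isolated types\<close>

text \<open>The formula isolating the type of \<open>e\<close> is satisfied in \<open>X\<close>, so
  the complete theory entails its existential closure. A witness in \<open>M\<close> then satisfies
  everything that the formula implies over \<open>T\<close>.\<close>

lemma atomic_tuple_realized:
  fixes M :: "nat struct"
  assumes T: "complete_theory T" and X: "atomic_model T X" and e: "range e \<subseteq> universe X"
    and M: "model T M"
  obtains a where "range a \<subseteq> universe M"
    "\<And>\<psi>. fv \<psi> \<subseteq> {..<n} \<Longrightarrow> sat X e \<psi> \<longleftrightarrow> sat M a \<psi>"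
proof -
  have Ts: "\<forall>\<phi>\<in>T. sentence \<phi>" using T by (simp add: complete_theory_def)
  have mX: "model T X" using X by (simp add: atomic_model_def)
  have "isolated_type T (tuple_type X n e)" using X e by (simp add: atomic_model_def)
  then obtain \<phi> where \<phi>: "fv \<phi> \<subseteq> {..<n}" "sat X e \<phi>"
    and iso: "\<And>\<psi>. fv \<psi> \<subseteq> {..<n} \<Longrightarrow> sat X e \<psi> \<Longrightarrow> entails T (Imp \<phi> \<psi>)"
    by (auto simp: isolated_type_def tuple_type_def)
  have sent: "sentence (exs n \<phi>)" using \<phi>(1) by (auto simp: sentence_def fv_exs)
  have "sat X e (exs n \<phi>)" unfolding sat_exs using e \<phi>(2) by (intro exI[of _ e]) auto
  then have "\<not> valid_in X (Neg (exs n \<phi>))" using e by (auto simp: valid_in_def)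
  \<comment> \<open>\<open>entails\<close> speaks of models on sets of naturals;
    \<open>entails_model\<close> makes it apply to \<open>X\<close>, whose type is
    arbitrary.\<close>
  then have "\<not> entails T (Neg (exs n \<phi>))" using entails_model[OF Ts _ mX] by blast
  then have "entails T (exs n \<phi>)" using T sent by (auto simp: complete_theory_def)
  then have val: "valid_in M (exs n \<phi>)" using M by (simp add: entails_def)
  \<comment> \<open>The value \<open>b\<close> from index \<open>n\<close> on keeps the whole
    assignment inside \<open>M\<close>, as \<open>valid_in\<close> demands.\<close>
  obtain b where b: "b \<in> universe M" using M by (auto simp: model_def is_structure_def)
  then have "sat M (\<lambda>_. b) (exs n \<phi>)" using val by (auto simp: valid_in_def)
  then obtain a where a: "\<forall>i<n. a i \<in> universe M" "\<forall>i\<ge>n. a i = b" "sat M a \<phi>"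
    by (auto simp: sat_exs)
  have ran: "range a \<subseteq> universe M"
  proof
    fix x assume "x \<in> range a"
    then obtain i where "x = a i" by blast
    then show "x \<in> universe M" using a b by (cases "i < n") auto
  qed
  have up: "sat M a \<psi>" if "fv \<psi> \<subseteq> {..<n}" "sat X e \<psi>" for \<psi>
    using iso[OF that] M a(3) ran by (auto simp: entails_def valid_in_def Imp_def)
  \<comment> \<open>The type of a tuple contains every formula or its negation, so the converse is
    \<open>up\<close> for \<open>Neg \<psi>\<close>.\<close>
  have "sat X e \<psi> \<longleftrightarrow> sat M a \<psi>" if "fv \<psi> \<subseteq> {..<n}" for \<psi>
    using up[of \<psi>] up[of "Neg \<psi>"] that by auto
  then show ?thesis using that ran by blast
qed

section \<open>Transferring the decomposition\<close>

lemma FLD1_decomposition_imp_lex_decomposition: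
  assumes "FLD1_decomposition X I D"
  shows "lex_decomposition X I D"
proof -
  have dj: "disjoint_family_on D (universe I)" and un: "(\<Union>i\<in>universe I. D i) = universe X"
    and X: "X = lex_sum I (\<lambda>i. induced X (D i))"
    using assms by (auto simp: FLD1_decomposition_def)
  have unique: "i = j" if "i \<in> universe I" "j \<in> universe I" "x \<in> D i" "x \<in> D j" for i j x
    using dj that by (auto simp: disjoint_family_on_def)
  have "(x, y) \<in> le X \<longleftrightarrow> (i, j) \<in> le I"
    if ij: "i \<in> universe I" "j \<in> universe I" "i \<noteq> j" and xy: "x \<in> D i" "y \<in> D j" for i j x y
  proof -
    have "(x, y) \<in> le X \<longleftrightarrow>
        (\<exists>k\<in>universe I. x \<in> D k \<and> y \<in> D k \<and> (x, y) \<in> le X) \<or>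
        (\<exists>k\<in>universe I. \<exists>l\<in>universe I. x \<in> D k \<and> y \<in> D l \<and> (k, l) \<in> le I \<and> k \<noteq> l)"
      by (subst X) (auto simp: lex_sum_def induced_def)
    then show ?thesis using unique ij xy by metis
  qed
  then show ?thesis using dj un by (simp add: lex_decomposition_def)
qed

text \<open>The parameter \<open>k < n\<close> stands for the largest element of the summand with index \<open>h k\<close>.\<close>

definition summand_fm :: "'i struct \<Rightarrow> nat \<Rightarrow> (nat \<Rightarrow> 'i) \<Rightarrow> 'i \<Rightarrow> nat \<Rightarrow> fm" where
  "summand_fm I n h i v =
     conjs (map (\<lambda>k. if (i, h k) \<in> le I then Leq v k else Neg (Leq v k)) [0..<n])"

text \<open>The set defined by \<open>summand_fm\<close> with parameters \<open>a\<close>. The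
  indices \<open>h k\<close> may repeat.\<close>

definition summand_of ::
  "'a struct \<Rightarrow> 'i struct \<Rightarrow> nat \<Rightarrow> (nat \<Rightarrow> 'i) \<Rightarrow> (nat \<Rightarrow> 'a) \<Rightarrow> 'i \<Rightarrow> 'a set" where
  "summand_of M I n h a i = {x \<in> universe M. \<forall>k<n. (x, a k) \<in> le M \<longleftrightarrow> (i, h k) \<in> le I}"

text \<open>Every \<open>conjs\<close> ends in \<open>Eq 0 0\<close>; with \<open>n > 0\<close> its
  variable counts as a parameter.\<close>

lemma fv_summand_fm: "n > 0 \<Longrightarrow> fv (summand_fm I n h i v) \<subseteq> insert v {..<n}"
  by (auto simp: summand_fm_def fv_conjs split: if_splits)

lemma sat_summand_fm:
  assumes "\<And>k. k < n \<Longrightarrow> e k = a k" "e v \<in> universe M"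
  shows "sat M e (summand_fm I n h i v) \<longleftrightarrow> e v \<in> summand_of M I n h a i"
proof -
  have "sat M e (if (i, h k) \<in> le I then Leq v k else Neg (Leq v k)) \<longleftrightarrow>
      ((e v, a k) \<in> le M \<longleftrightarrow> (i, h k) \<in> le I)" if "k < n" for k
    using assms(1)[OF that] by simp
  then have "(\<forall>k\<in>{0..<n}. sat M e (if (i, h k) \<in> le I then Leq v k else Neg (Leq v k))) \<longleftrightarrow>
      (\<forall>k<n. (e v, a k) \<in> le M \<longleftrightarrow> (i, h k) \<in> le I)"
    by (simp only: atLeastLessThan_iff Ball_def) auto
  then show ?thesis
    using assms(2) unfolding summand_fm_def summand_of_def sat_conjs set_map ball_simps set_upt by simp
qed

lemma summand_of_subset: "summand_of M I n h a i \<subseteq> universe M"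
  by (auto simp: summand_of_def)

text \<open>The bound variable \<open>n\<close> is the first one beyond the parameters. A finite
  disjunction over the indices \<open>h l\<close> is written as a negated conjunction.\<close>

definition covering_fm :: "'i struct \<Rightarrow> nat \<Rightarrow> (nat \<Rightarrow> 'i) \<Rightarrow> fm" where
  "covering_fm I n h = Neg (Exists n (conjs (map (\<lambda>l. Neg (summand_fm I n h (h l) n)) [0..<n])))"

definition nonempty_fm :: "'i struct \<Rightarrow> nat \<Rightarrow> (nat \<Rightarrow> 'i) \<Rightarrow> 'i \<Rightarrow> fm" where
  "nonempty_fm I n h i = Exists n (summand_fm I n h i n)"

text \<open>Whether \<open>i\<close> is below \<open>j\<close> is settled when the formula is built,
  so it only has to exclude pairs with the wrong comparison.\<close>

definition order_fm :: "'i struct \<Rightarrow> nat \<Rightarrow> (nat \<Rightarrow> 'i) \<Rightarrow> 'i \<Rightarrow> 'i \<Rightarrow> fm" where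
  "order_fm I n h i j =
     Neg (Exists n (Exists (Suc n) (Conj (Conj (summand_fm I n h i n) (summand_fm I n h j (Suc n)))
       (if (i, j) \<in> le I then Neg (Leq n (Suc n)) else Leq n (Suc n)))))"

lemma fv_covering_fm: "n > 0 \<Longrightarrow> fv (covering_fm I n h) \<subseteq> {..<n}"
  using fv_summand_fm[of n I h _ n] by (fastforce simp: covering_fm_def fv_conjs)

lemma fv_nonempty_fm: "n > 0 \<Longrightarrow> fv (nonempty_fm I n h i) \<subseteq> {..<n}"
  using fv_summand_fm[of n I h i n] by (auto simp: nonempty_fm_def)

lemma fv_order_fm: "n > 0 \<Longrightarrow> fv (order_fm I n h i j) \<subseteq> {..<n}"
  using fv_summand_fm[of n I h i n] fv_summand_fm[of n I h j "Suc n"]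
  by (auto simp: order_fm_def)

lemma sat_summand_fm_upd:
  assumes "x \<in> universe M"
  shows "sat M (a(n := x)) (summand_fm I n h i n) \<longleftrightarrow> x \<in> summand_of M I n h a i"
  using sat_summand_fm[of n "a(n := x)" a n M I h i] assms by simp

lemma sat_covering_fm:
  "sat M a (covering_fm I n h) \<longleftrightarrow> universe M \<subseteq> (\<Union>i\<in>h ` {..<n}. summand_of M I n h a i)"
  using sat_summand_fm_upd[of _ M a n I h] by (fastforce simp: covering_fm_def sat_conjs)

lemma sat_nonempty_fm: "sat M a (nonempty_fm I n h i) \<longleftrightarrow> summand_of M I n h a i \<noteq> {}"
  using sat_summand_fm_upd[of _ M a n I h i] summand_of_subset[of M I n h a i]
  by (auto simp: nonempty_fm_def)

lemma sat_order_fm: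
  "sat M a (order_fm I n h i j) \<longleftrightarrow>
     (\<forall>x\<in>summand_of M I n h a i. \<forall>y\<in>summand_of M I n h a j. (x, y) \<in> le M \<longleftrightarrow> (i, j) \<in> le I)"
proof -
  have "sat M (a(n := x, Suc n := y)) (summand_fm I n h i n) \<longleftrightarrow> x \<in> summand_of M I n h a i"
    "sat M (a(n := x, Suc n := y)) (summand_fm I n h j (Suc n)) \<longleftrightarrow> y \<in> summand_of M I n h a j"
    if "x \<in> universe M" "y \<in> universe M" for x y
    using that sat_summand_fm[of n "a(n := x, Suc n := y)" a n M I h i]
      sat_summand_fm[of n "a(n := x, Suc n := y)" a "Suc n" M I h j] by simp_all
  then show ?thesis
    using summand_of_subset[of M I n h a i] summand_of_subset[of M I n h a j]
    by (simp add: order_fm_def) blast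
qed

text \<open>Covering and the comparisons between parts are expressed by formulas in the parameters,
  hence pass from \<open>X\<close> to \<open>M\<close>. Disjointness comes from \<open>I\<close>
  alone: an element reveals which indices lie above its own, and antisymmetry recovers the index
  from them.\<close>

lemma lex_decomposition_summand_of_transfer:
  fixes X :: "'a struct" and M :: "'b struct"
  assumes n: "n > 0" and I: "partial_order I" and h: "h ` {..<n} = universe I"
    and X: "lex_decomposition X I (summand_of X I n h e)"
    and ea: "\<And>\<psi>. fv \<psi> \<subseteq> {..<n} \<Longrightarrow> sat X e \<psi> \<longleftrightarrow> sat M a \<psi>"
  shows "lex_decomposition M I (summand_of M I n h a)"
proof -
  have "disjoint_family_on (summand_of M I n h a) (universe I)"
    unfolding disjoint_family_on_def
  proof (intro ballI impI)
    fix i j assume ij: "i \<in> universe I" "j \<in> universe I" "i \<noteq> j"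
    have "i = j" if x: "x \<in> summand_of M I n h a i" "x \<in> summand_of M I n h a j" for x
    proof -
      have "(i, k) \<in> le I \<longleftrightarrow> (j, k) \<in> le I" if "k \<in> universe I" for k
        using x that by (auto simp: summand_of_def h[symmetric])
      moreover have "(i, i) \<in> le I" "(j, j) \<in> le I"
        using I ij by (auto simp: partial_order_def partial_order_on_def preorder_on_def refl_on_def)
      ultimately have "(i, j) \<in> le I" "(j, i) \<in> le I" using ij by auto
      then show ?thesis using I by (auto simp: partial_order_def partial_order_on_def antisym_def)
    qed
    then show "summand_of M I n h a i \<inter> summand_of M I n h a j = {}" using ij by blast
  qed
  moreover have "(\<Union>i\<in>universe I. summand_of M I n h a i) = universe M"
  proof -
    have "sat X e (covering_fm I n h)"
      using X unfolding sat_covering_fm h by (simp add: lex_decomposition_def)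
    then have "sat M a (covering_fm I n h)" using ea[OF fv_covering_fm[OF n, of I h]] by simp
    then show ?thesis unfolding sat_covering_fm h using summand_of_subset by fastforce
  qed
  moreover have "(x, y) \<in> le M \<longleftrightarrow> (i, j) \<in> le I"
    if ij: "i \<in> universe I" "j \<in> universe I" "i \<noteq> j"
      and xy: "x \<in> summand_of M I n h a i" "y \<in> summand_of M I n h a j" for i j x y
  proof -
    have "sat X e (order_fm I n h i j)"
      using X ij unfolding sat_order_fm by (simp add: lex_decomposition_def)
    then have "sat M a (order_fm I n h i j)" using ea[OF fv_order_fm[OF n, of I h i j]] by simp
    then show ?thesis unfolding sat_order_fm using xy by blast
  qed
  ultimately show ?thesis by (simp add: lex_decomposition_def)
qed

text \<open>Relativized to the part, a sentence becomes a formula in the parameters, on which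
  \<open>e\<close> and \<open>a\<close> agree.\<close>

lemma model_Th_summand_of_transfer:
  fixes X :: "'a struct" and M :: "'b struct"
  assumes n: "n > 0" and ne: "summand_of X I n h e i \<noteq> {}"
    and ea: "\<And>\<psi>. fv \<psi> \<subseteq> {..<n} \<Longrightarrow> sat X e \<psi> \<longleftrightarrow> sat M a \<psi>"
  shows "model (Th (induced X (summand_of X I n h e i))) (induced M (summand_of M I n h a i))"
proof -
  let ?\<delta> = "summand_fm I n h i"
  have ne': "summand_of M I n h a i \<noteq> {}"
    using ne ea[OF fv_nonempty_fm[OF n, of I h i]] by (simp add: sat_nonempty_fm)
  have "valid_in (induced M (summand_of M I n h a i)) \<phi>"
    if \<phi>: "sentence \<phi>" "valid_in (induced X (summand_of X I n h e i)) \<phi>" for \<phi>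
  proof -
    have "valid_in (induced X (summand_of X I n h e i)) \<phi> \<longleftrightarrow> sat X e (relativize n ?\<delta> \<phi>)"
      by (rule induced_part_valid_iff[OF sat_summand_fm fv_summand_fm[OF n] summand_of_subset ne \<phi>(1)])
    moreover have "valid_in (induced M (summand_of M I n h a i)) \<phi> \<longleftrightarrow> sat M a (relativize n ?\<delta> \<phi>)"
      by (rule induced_part_valid_iff[OF sat_summand_fm fv_summand_fm[OF n] summand_of_subset ne' \<phi>(1)])
    moreover have "fv (relativize n ?\<delta> \<phi>) \<subseteq> {..<n}"
      using fv_relativize[of ?\<delta> n \<phi>, OF fv_summand_fm[OF n]] \<phi>(1) by (auto simp: sentence_def)
    ultimately show ?thesis using ea \<phi>(2) by blast
  qed
  then show ?thesis using ne' by (auto simp: model_def Th_def is_structure_def induced_def)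
qed

lemma model_lex_decomposition:
  fixes X :: "'a struct" and M :: "nat struct"
  assumes T: "complete_theory T" and X: "atomic_model T X" and D: "FLD1_decomposition X I D"
    and M: "model T M"
  obtains P where "lex_decomposition M I P"
    "\<And>i. i \<in> universe I \<Longrightarrow> model (Th (induced X (D i))) (induced M (P i))"
proof -
  have fin: "finite (universe I)" and I: "partial_order I"
    and un: "(\<Union>i\<in>universe I. D i) = universe X"
    and lar: "\<forall>i\<in>universe I. has_largest (induced X (D i))"
    using D by (auto simp: FLD1_decomposition_def)
  have lex: "lex_decomposition X I D" by (rule FLD1_decomposition_imp_lex_decomposition[OF D])
  have "universe X \<noteq> {}" using X by (auto simp: atomic_model_def model_def is_structure_def)
  then have I_ne: "universe I \<noteq> {}" using un by auto
  obtain hs where hs: "set hs = universe I" using fin finite_list by blast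
  \<comment> \<open>The value \<open>hs ! 0\<close> from \<open>n\<close> on keeps all of
    \<open>e = m \<circ> h\<close> inside \<open>X\<close>; only the first \<open>n\<close> entries
    matter as parameters.\<close>
  define n h where "n = length hs" and "h = (\<lambda>k. if k < n then hs ! k else hs ! 0)"
  have n: "n > 0" using hs I_ne by (auto simp: n_def)
  have h: "h ` {..<n} = universe I" unfolding hs[symmetric] set_conv_nth by (auto simp: h_def n_def)
  have h_in: "h k \<in> universe I" for k
    unfolding hs[symmetric] using n by (simp add: h_def n_def)
  obtain m where m: "\<And>i. i \<in> universe I \<Longrightarrow> m i \<in> D i"
    "\<And>i x. i \<in> universe I \<Longrightarrow> x \<in> D i \<Longrightarrow> (x, m i) \<in> le X"
    using lar unfolding has_largest_def by (simp add: induced_def) metis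
  define e where "e = m \<circ> h"
  have e: "range e \<subseteq> universe X" using m(1) h_in un by (auto simp: e_def)
  have I_refl: "(i, i) \<in> le I" if "i \<in> universe I" for i
    using I that by (auto simp: partial_order_def partial_order_on_def preorder_on_def refl_on_def)
  \<comment> \<open>Inside one summand \<open>m j\<close> is largest and \<open>I\<close> is
    reflexive; across summands the order is that of \<open>I\<close>.\<close>
  have below: "(x, m j) \<in> le X \<longleftrightarrow> (i, j) \<in> le I"
    if "i \<in> universe I" "j \<in> universe I" "x \<in> D i" for i j x
    using lex m that I_refl unfolding lex_decomposition_def by (cases "i = j") auto
  have D_eq: "summand_of X I n h e i = D i" if i: "i \<in> universe I" for i
  proof
    show "D i \<subseteq> summand_of X I n h e i"
      using below[OF i] h_in i un by (auto simp: summand_of_def e_def)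
    show "summand_of X I n h e i \<subseteq> D i"
    proof
      fix x assume x: "x \<in> summand_of X I n h e i"
      then have "x \<in> universe X" by (simp add: summand_of_def)
      then obtain j where j: "j \<in> universe I" "x \<in> D j" using un by auto
      have "(i, k) \<in> le I \<longleftrightarrow> (j, k) \<in> le I" if k: "k \<in> universe I" for k
      proof -
        obtain l where "l < n" "k = h l" using k unfolding h[symmetric] by auto
        then show ?thesis using x below[OF j(1) k j(2)] by (auto simp: summand_of_def e_def)
      qed
      \<comment> \<open>The equivalence is used at \<open>k = j\<close> and at
        \<open>k = i\<close>.\<close>
      then have "(i, j) \<in> le I" "(j, i) \<in> le I" using I_refl i j by auto
      then have "i = j" using I by (auto simp: partial_order_def partial_order_on_def antisym_def)
      then show "x \<in> D i" using j by simp
    qed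
  qed
  obtain a where ea: "\<And>\<psi>. fv \<psi> \<subseteq> {..<n} \<Longrightarrow> sat X e \<psi> \<longleftrightarrow> sat M a \<psi>"
    using atomic_tuple_realized[OF T X e M] by metis
  have "lex_decomposition X I (summand_of X I n h e)"
    using lex D_eq by (simp add: lex_decomposition_def disjoint_family_on_def)
  then have "lex_decomposition M I (summand_of M I n h a)"
    using lex_decomposition_summand_of_transfer[OF n I h _ ea] by blast
  moreover have "model (Th (induced X (D i))) (induced M (summand_of M I n h a i))"
    if "i \<in> universe I" for i
  proof -
    have "summand_of X I n h e i \<noteq> {}" using m(1)[OF that] D_eq[OF that] by auto
    from model_Th_summand_of_transfer[OF n this ea] show ?thesis using D_eq[OF that] by simp
  qed
  ultimately show ?thesis using that by blast
qed

section \<open>Counting isomorphism classes\<close>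

lemma isomorphic_refl: "isomorphic M M"
  unfolding isomorphic_def is_iso_def by (intro exI[of _ id]) simp

lemma equiv_isomorphic:
  "equiv {M :: nat struct. model T M} {(M, N). model T M \<and> model T N \<and> isomorphic M N}"
  by (intro equivI refl_onI symI transI)
    (auto intro: isomorphic_refl isomorphic_sym isomorphic_trans)

theorem theorem3p5:
  fixes T :: "fm set" and X :: "'a struct" and I :: "'i struct" and D :: "'i \<Rightarrow> 'a set"
  assumes "FLD1_theory T"
    and "atomic_model T X"
    and "FLD1_decomposition X I D"
  shows "num_models T \<le>o cardinal_prod (universe I) (\<lambda>i. num_models_of (induced X (D i)))"
proof -
  have T: "complete_theory T" using assms(1) by (simp add: FLD1_theory_def)
  define R where "R T = {(M :: nat struct, N :: nat struct). model T M \<and> model T N \<and> isomorphic M N}" for T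
  have R: "equiv {M. model T M} (R T)" for T unfolding R_def by (rule equiv_isomorphic)
  have cls: "iso_classes T = {M. model T M} // R T" for T by (simp add: iso_classes_def R_def)
  let ?T = "\<lambda>i. Th (induced X (D i))"
  \<comment> \<open>The parts depend on the tuple chosen in \<open>M\<close>, so one decomposition
    is fixed for each model.\<close>
  have "\<forall>M :: nat struct. \<exists>P. model T M \<longrightarrow>
      lex_decomposition M I P \<and> (\<forall>i\<in>universe I. model (?T i) (induced M (P i)))"
    using model_lex_decomposition[OF T assms(2,3)] by metis
  then obtain P where P: "\<And>M :: nat struct. model T M \<Longrightarrow> lex_decomposition M I (P M)"
    "\<And>(M :: nat struct) i. model T M \<Longrightarrow> i \<in> universe I \<Longrightarrow> model (?T i) (induced M (P M i))"
    by metis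
  have "\<forall>c\<in>iso_classes T. \<exists>M. model T M \<and> c = R T `` {M}"
    by (auto simp: cls elim: quotientE)
  then obtain rep where rep: "\<And>c. c \<in> iso_classes T \<Longrightarrow> model T (rep c)"
    "\<And>c. c \<in> iso_classes T \<Longrightarrow> c = R T `` {rep c}"
    by metis
  \<comment> \<open>\<open>F\<close> looks only at the chosen representative of a class, so it is
    well defined without any invariance of \<open>P\<close> under isomorphism.\<close>
  define F where "F c = (\<lambda>i\<in>universe I. R (?T i) `` {induced (rep c) (P (rep c) i)})" for c
  have "F c \<in> (\<Pi>\<^sub>E i\<in>universe I. iso_classes (?T i))" if "c \<in> iso_classes T" for c
    using P(2)[OF rep(1)[OF that]] by (auto simp: F_def cls intro!: quotientI)
  moreover have "inj_on F (iso_classes T)"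
  proof (rule inj_onI)
    fix c d assume c: "c \<in> iso_classes T" and d: "d \<in> iso_classes T" and eq: "F c = F d"
    have "isomorphic (induced (rep c) (P (rep c) i)) (induced (rep d) (P (rep d) i))"
      if i: "i \<in> universe I" for i
    proof -
      have "R (?T i) `` {induced (rep c) (P (rep c) i)} = R (?T i) `` {induced (rep d) (P (rep d) i)}"
        using fun_cong[OF eq, of i] i by (simp add: F_def)
      then have "(induced (rep c) (P (rep c) i), induced (rep d) (P (rep d) i)) \<in> R (?T i)"
        using P(2)[OF rep(1)[OF d] i] by (intro eq_equiv_class[OF _ R]) auto
      then show ?thesis by (simp add: R_def)
    qed
    \<comment> \<open>Both representatives are decomposed over the same \<open>I\<close>, so the
      isomorphisms of their summands glue.\<close>
    then have "isomorphic (rep c) (rep d)"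
      using isomorphic_if_summands_isomorphic P(1) rep(1) c d by blast
    then have "(rep c, rep d) \<in> R T" using rep(1) c d by (simp add: R_def)
    then have "R T `` {rep c} = R T `` {rep d}" by (rule equiv_class_eq[OF R])
    then show "c = d" using rep(2)[OF c] rep(2)[OF d] by simp
  qed
  ultimately have "|iso_classes T| \<le>o |\<Pi>\<^sub>E i\<in>universe I. iso_classes (?T i)|"
    by (intro card_of_ordLeq[THEN iffD1] exI[of _ F]) auto
  then show ?thesis
    by (simp add: num_models_def cardinal_prod_def num_models_of_def Field_card_of)
qed

end
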